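(* (1) A space $X$ is almost Scheepers if and only if for every sequence $(\mathcal{U}_n)_{n\in\mathbb{N}}$ of covers of $X$ by regular-open sets there is a sequence $(\mathcal{V}_n)$ such that for each $n$ $\mathcal{V}_n$ is a finite subset of $\mathcal{U}_n$ and for each finite set $F\subseteq X$ there is an $n$ such that $F\subseteq\overline{\bigcup\mathcal{V}_n}$. (2) A space $X$ is weakly Scheepers (in the sense of Sakai) if and only if for every sequence $(\mathcal{U}_n)$ of covers of $X$ by regular-open sets there exists a sequence $(\mathcal{V}_n)$ such that for each $n$ $\mathcal{V}_n$ is a finite subset of $\mathcal{U}_n$ and for each finite collection $\mathcal{F}$ of nonempty regular-open sets there is an $n$ such that $U\cap\left(\bigcup\mathcal{V}_n\right)\neq\emptyset$ for all $U\in\mathcal{F}$. (3) Suppose that $X$ is regular. Then $X$ is weakly Scheepers in the sense of Kočinac if and only if for every sequence $(\mathcal{U}_n)$ of covers of $X$ by regular-open sets there exist a dense subset $Y$ of $X$ and a sequence $(\mathcal{V}_n)$ such that for each $n$ $\mathcal{V}_n$ is a finite subset of $\mathcal{U}_n$ and for each finite set $F\subseteq Y$ there is an $n$ such that $F\subseteq\bigcup\mathcal{V}_n$.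
   Context: A subset $A$ of a space $X$ is regular-open if $\mathrm{Int}(\overline{A})=A$. In each item below the condition is required for every sequence $(\mathcal{U}_n)_{n\in\mathbb{N}}$ of open covers of $X$. $X$ is almost Scheepers if there are finite $\mathcal{V}_n\subseteq\mathcal{U}_n$ such that every finite set $F\subseteq X$ is contained in $\overline{\bigcup\mathcal{V}_n}$ for some $n$. $X$ is weakly Scheepers (in the sense of Sakai) if there are finite $\mathcal{V}_n\subseteq\mathcal{U}_n$ such that for every finite collection $\mathcal{F}$ of nonempty open subsets of $X$ there is an $n$ with $U\cap\left(\bigcup\mathcal{V}_n\right)\neq\emptyset$ for all $U\in\mathcal{F}$. $X$ is weakly Scheepers in the sense of Kočinac if there are a dense set $Y\subseteq X$ and finite $\mathcal{V}_n\subseteq\mathcal{U}_n$ such that every finite set $F\subseteq Y$ is contained in $\bigcup\mathcal{V}_n$ for some $n$. *)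

theory Defs
  imports "HOL-Analysis.Abstract_Topological_Spaces"
begin

definition regular_open_in :: "'a topology \<Rightarrow> 'a set \<Rightarrow> bool" where
  "regular_open_in X A \<longleftrightarrow>
     A \<subseteq> topspace X \<and> X interior_of (X closure_of A) = A"

definition dense_in :: "'a topology \<Rightarrow> 'a set \<Rightarrow> bool" where
  "dense_in X Y \<longleftrightarrow> Y \<subseteq> topspace X \<and> X closure_of Y = topspace X"

definition open_cover :: "'a topology \<Rightarrow> 'a set set \<Rightarrow> bool" where
  "open_cover X \<U> \<longleftrightarrow> (\<forall>U\<in>\<U>. openin X U) \<and> \<Union>\<U> = topspace X"

definition regular_open_cover :: "'a topology \<Rightarrow> 'a set set \<Rightarrow> bool" where
  "regular_open_cover X \<U> \<longleftrightarrow>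
     (\<forall>U\<in>\<U>. regular_open_in X U) \<and> \<Union>\<U> = topspace X"

definition almost_Scheepers :: "'a topology \<Rightarrow> bool" where
  "almost_Scheepers X \<longleftrightarrow>
     (\<forall>\<U> :: nat \<Rightarrow> 'a set set. (\<forall>n. open_cover X (\<U> n)) \<longrightarrow>
       (\<exists>\<V> :: nat \<Rightarrow> 'a set set. (\<forall>n. finite (\<V> n) \<and> \<V> n \<subseteq> \<U> n) \<and>
         (\<forall>F. finite F \<and> F \<subseteq> topspace X \<longrightarrow>
           (\<exists>n. F \<subseteq> X closure_of \<Union>(\<V> n)))))"

definition weakly_Scheepers_Sakai :: "'a topology \<Rightarrow> bool" where
  "weakly_Scheepers_Sakai X \<longleftrightarrow>
     (\<forall>\<U> :: nat \<Rightarrow> 'a set set. (\<forall>n. open_cover X (\<U> n)) \<longrightarrow>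
       (\<exists>\<V> :: nat \<Rightarrow> 'a set set. (\<forall>n. finite (\<V> n) \<and> \<V> n \<subseteq> \<U> n) \<and>
         (\<forall>\<F>. finite \<F> \<and> (\<forall>U\<in>\<F>. openin X U \<and> U \<noteq> {}) \<longrightarrow>
           (\<exists>n. \<forall>U\<in>\<F>. U \<inter> \<Union>(\<V> n) \<noteq> {}))))"

(* The dense set Y may depend on the sequence of covers. *)
definition weakly_Scheepers_Kocinac :: "'a topology \<Rightarrow> bool" where
  "weakly_Scheepers_Kocinac X \<longleftrightarrow>
     (\<forall>\<U> :: nat \<Rightarrow> 'a set set. (\<forall>n. open_cover X (\<U> n)) \<longrightarrow>
       (\<exists>Y. \<exists>\<V> :: nat \<Rightarrow> 'a set set. dense_in X Y \<and>
         (\<forall>n. finite (\<V> n) \<and> \<V> n \<subseteq> \<U> n) \<and>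
         (\<forall>F. finite F \<and> F \<subseteq> Y \<longrightarrow> (\<exists>n. F \<subseteq> \<Union>(\<V> n)))))"

end

theory Submission
  imports Defs
begin

text \<open>
  Every regular-open cover is an open cover. Conversely, an open cover is replaced by a regular-open
  cover each of whose members lies in the closure of a member of the given cover, namely by the sets
  \<open>int (cl U)\<close>; this loses nothing up to closures, which is all that (1) and (2) see. In a regular
  space the regular-open sets form a base, so in (3) the cover has a genuine regular-open refinement.
\<close>

section \<open>Regular-open sets and covers by them\<close>

lemma regular_open_in_imp_openin: "regular_open_in X A \<Longrightarrow> openin X A"
  unfolding regular_open_in_def by (metis openin_interior_of)

lemma regular_open_cover_imp_open_cover: "regular_open_cover X \<U> \<Longrightarrow> open_cover X \<U>"
  unfolding regular_open_cover_def open_cover_def using regular_open_in_imp_openin by blast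

lemma openin_subset_interior_of_closure_of:
  "openin X U \<Longrightarrow> U \<subseteq> X interior_of (X closure_of U)"
  by (simp add: closure_of_subset interior_of_maximal openin_subset)

text \<open>The closure of \<open>X interior_of (X closure_of S)\<close> stays inside the closed set
  \<open>X closure_of S\<close>, so a second round of closure and interior adds nothing; it removes
  nothing because the set is already open. This holds for arbitrary \<open>S\<close> and is the
  source of all regular-open sets below.\<close>

lemma regular_open_in_interior_of_closure_of:
  "regular_open_in X (X interior_of (X closure_of S))"
  unfolding regular_open_in_def
proof (intro conjI subset_antisym interior_of_subset_topspace)
  have "X closure_of (X interior_of (X closure_of S)) \<subseteq> X closure_of S"
    by (simp add: closure_of_minimal interior_of_subset)
  then show "X interior_of (X closure_of (X interior_of (X closure_of S)))
      \<subseteq> X interior_of (X closure_of S)"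
    by (rule interior_of_mono)
qed (simp add: openin_subset_interior_of_closure_of)

lemma openin_Int_closure_of_nonempty:
  assumes "openin X U" "U \<inter> X closure_of S \<noteq> {}"
  shows "U \<inter> S \<noteq> {}"
  using assms openin_Int_closure_of_eq_empty by blast

lemma openin_open_cover: "open_cover X \<U> \<Longrightarrow> \<V> \<subseteq> \<U> \<Longrightarrow> openin X (\<Union>\<V>)"
  unfolding open_cover_def by blast

text \<open>An open set only grows under interior of closure, so no point of the space becomes
  uncovered.\<close>

lemma regular_open_cover_interior_of_closure_of:
  assumes "open_cover X \<U>"
  shows "regular_open_cover X ((\<lambda>U. X interior_of (X closure_of U)) ` \<U>)"
proof -
  have "\<Union>\<U> \<subseteq> (\<Union>U\<in>\<U>. X interior_of (X closure_of U))"
    using assms openin_subset_interior_of_closure_of unfolding open_cover_def by fastforce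
  moreover have "(\<Union>U\<in>\<U>. X interior_of (X closure_of U)) \<subseteq> topspace X"
    using interior_of_subset_topspace by fastforce
  ultimately show ?thesis
    using assms regular_open_in_interior_of_closure_of
    unfolding regular_open_cover_def open_cover_def by blast
qed

text \<open>Regularity is used as a base of closed neighbourhoods: with \<open>W\<close> open and
  \<open>C\<close> closed, \<open>W \<subseteq> C \<subseteq> U\<close>, the closure of
  \<open>W\<close> cannot leave \<open>C\<close>, so the regular-open set
  \<open>X interior_of (X closure_of W)\<close> lies between \<open>W\<close> and
  \<open>U\<close>.\<close>

lemma regular_space_regular_open_base:
  assumes "regular_space X" "openin X U" "x \<in> U"
  obtains R where "regular_open_in X R" "x \<in> R" "R \<subseteq> U"
proof -
  obtain W C where WC: "openin X W" "closedin X C" "x \<in> W" "W \<subseteq> C" "C \<subseteq> U"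
    using assms unfolding neighbourhood_base_of_closedin [symmetric] neighbourhood_base_of
    by meson
  have "X interior_of (X closure_of W) \<subseteq> U"
    using WC closure_of_minimal interior_of_subset by (metis order_trans)
  then show thesis
    using that regular_open_in_interior_of_closure_of openin_subset_interior_of_closure_of WC
    by blast
qed

text \<open>Taking every regular-open set subordinate to the cover avoids choosing one for each
  point; the base property shows that these sets reach every point.\<close>

lemma regular_open_cover_refinement:
  assumes "regular_space X" "open_cover X \<U>"
  shows "regular_open_cover X {R. regular_open_in X R \<and> (\<exists>U\<in>\<U>. R \<subseteq> U)}"
proof -
  have "topspace X \<subseteq> \<Union>{R. regular_open_in X R \<and> (\<exists>U\<in>\<U>. R \<subseteq> U)}"
  proof
    fix x assume x: "x \<in> topspace X"
    then obtain U where U: "U \<in> \<U>" "x \<in> U" "openin X U"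
      using assms(2) unfolding open_cover_def by blast
    then obtain R where R: "regular_open_in X R" "x \<in> R" "R \<subseteq> U"
      using regular_space_regular_open_base [OF assms(1), of U x] by blast
    have "R \<in> {R. regular_open_in X R \<and> (\<exists>U\<in>\<U>. R \<subseteq> U)}"
      using R(1,3) U(1) by auto
    then show "x \<in> \<Union>{R. regular_open_in X R \<and> (\<exists>U\<in>\<U>. R \<subseteq> U)}"
      using R(2) by (rule UnionI)
  qed
  moreover have "\<Union>{R. regular_open_in X R \<and> (\<exists>U\<in>\<U>. R \<subseteq> U)} \<subseteq> topspace X"
    by (auto simp: regular_open_in_def)
  ultimately have "\<Union>{R. regular_open_in X R \<and> (\<exists>U\<in>\<U>. R \<subseteq> U)} = topspace X"
    by (rule subset_antisym [rotated])
  then show ?thesis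
    unfolding regular_open_cover_def by (intro conjI ballI) (simp only: mem_Collect_eq)
qed

section \<open>Finite subfamilies: from the auxiliary covers back to the given ones\<close>

text \<open>Choosing one related \<open>U\<close> for each \<open>W\<close> gives images of finite
  families, hence finite families. The relation \<open>P\<close> is kept abstract to serve both
  kinds of auxiliary cover: inclusion in the closure of \<open>U\<close> for (1) and (2), plain
  inclusion for (3).\<close>

lemma finite_subfamilies_via_relation:
  assumes "\<And>n. finite (\<W> n)" "\<And>n W. W \<in> \<W> n \<Longrightarrow> \<exists>U\<in>\<U> n. P W U"
  obtains \<V> where "\<forall>n. finite (\<V> n) \<and> \<V> n \<subseteq> \<U> n"
    "\<forall>n. \<forall>W\<in>\<W> n. \<exists>U\<in>\<V> n. P W U"
proof -
  define g where "g n W = (SOME U. U \<in> \<U> n \<and> P W U)" for n W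
  have g: "g n W \<in> \<U> n \<and> P W (g n W)" if "W \<in> \<W> n" for n W
    unfolding g_def by (rule someI_ex) (use assms(2) [OF that] in blast)
  show thesis
  proof (rule that [of "\<lambda>n. g n ` \<W> n"])
    show "\<forall>n. finite (g n ` \<W> n) \<and> g n ` \<W> n \<subseteq> \<U> n"
      using assms(1) g by (simp add: image_subset_iff)
    show "\<forall>n. \<forall>W\<in>\<W> n. \<exists>U\<in>g n ` \<W> n. P W U"
    proof (intro allI ballI)
      fix n W assume "W \<in> \<W> n"
      with g show "\<exists>U\<in>g n ` \<W> n. P W U"
        by (intro bexI [of _ "g n W"] imageI) simp_all
    qed
  qed
qed

text \<open>A member of \<open>\<W> n\<close> is the interior of the closure of some
  \<open>U\<close>, hence lies in the closure of that \<open>U\<close>; closure is monotone, so this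
  lies in the closure of the whole union.\<close>

lemma finite_subfamilies_dense:
  assumes "\<And>n. finite (\<W> n)"
    "\<And>n. \<W> n \<subseteq> (\<lambda>U. X interior_of (X closure_of U)) ` \<U> n"
  obtains \<V> where "\<forall>n. finite (\<V> n) \<and> \<V> n \<subseteq> \<U> n"
    "\<forall>n. \<Union>(\<W> n) \<subseteq> X closure_of \<Union>(\<V> n)"
proof -
  have W: "\<exists>U\<in>\<U> n. W \<subseteq> X closure_of U" if mem: "W \<in> \<W> n" for n W
  proof -
    obtain U where "U \<in> \<U> n" "W = X interior_of (X closure_of U)"
      using subsetD [OF assms(2) mem] by (rule imageE)
    then show ?thesis
      using interior_of_subset by (intro bexI [of _ U]) simp_all
  qed
  obtain \<V> where V: "\<forall>n. finite (\<V> n) \<and> \<V> n \<subseteq> \<U> n"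
    "\<forall>n. \<forall>W\<in>\<W> n. \<exists>U\<in>\<V> n. W \<subseteq> X closure_of U"
    by (rule finite_subfamilies_via_relation
        [of \<W> \<U> "\<lambda>W U. W \<subseteq> X closure_of U", OF assms(1) W])
  have "\<Union>(\<W> n) \<subseteq> X closure_of \<Union>(\<V> n)" for n
  proof (rule Union_least)
    fix W assume "W \<in> \<W> n"
    then obtain U where "U \<in> \<V> n" "W \<subseteq> X closure_of U"
      using V(2) by blast
    then show "W \<subseteq> X closure_of \<Union>(\<V> n)"
      using closure_of_mono [of U "\<Union>(\<V> n)" X] by blast
  qed
  then have "\<forall>n. \<Union>(\<W> n) \<subseteq> X closure_of \<Union>(\<V> n)"
    by (rule allI)
  with V(1) show thesis
    by (rule that)
qed

section \<open>The three equivalences\<close>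

lemma almost_Scheepers_iff_regular_open:
  "almost_Scheepers X \<longleftrightarrow>
    (\<forall>\<U> :: nat \<Rightarrow> 'a set set. (\<forall>n. regular_open_cover X (\<U> n)) \<longrightarrow>
      (\<exists>\<V> :: nat \<Rightarrow> 'a set set. (\<forall>n. finite (\<V> n) \<and> \<V> n \<subseteq> \<U> n) \<and>
        (\<forall>F. finite F \<and> F \<subseteq> topspace X \<longrightarrow> (\<exists>n. F \<subseteq> X closure_of \<Union>(\<V> n)))))"
  (is "_ \<longleftrightarrow> ?R")
proof
  assume "almost_Scheepers X"
  then show ?R
    unfolding almost_Scheepers_def by (simp add: regular_open_cover_imp_open_cover)
next
  assume R: ?R
  show "almost_Scheepers X"
    unfolding almost_Scheepers_def
  proof (intro allI impI)
    fix \<U> :: "nat \<Rightarrow> 'a set set"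
    assume U: "\<forall>n. open_cover X (\<U> n)"
    define \<U>' where "\<U>' n = (\<lambda>U. X interior_of (X closure_of U)) ` \<U> n" for n
    have "\<forall>n. regular_open_cover X (\<U>' n)"
      unfolding \<U>'_def using U regular_open_cover_interior_of_closure_of by blast
    then obtain \<W> where W: "\<forall>n. finite (\<W> n) \<and> \<W> n \<subseteq> \<U>' n"
      "\<forall>F. finite F \<and> F \<subseteq> topspace X \<longrightarrow> (\<exists>n. F \<subseteq> X closure_of \<Union>(\<W> n))"
      using R [THEN spec, of \<U>'] by blast
    have fin: "finite (\<W> n)"
      and sub: "\<W> n \<subseteq> (\<lambda>U. X interior_of (X closure_of U)) ` \<U> n" for n
      using W(1) by (simp_all add: \<U>'_def)
    obtain \<V> where V: "\<forall>n. finite (\<V> n) \<and> \<V> n \<subseteq> \<U> n"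
      "\<forall>n. \<Union>(\<W> n) \<subseteq> X closure_of \<Union>(\<V> n)"
      by (rule finite_subfamilies_dense [of \<W> X \<U>, OF fin sub])
    \<comment> \<open>The right-hand side is closed, so containing \<open>\<Union>(\<W> n)\<close>
      it also contains its closure. The index \<open>n\<close> found for \<open>\<W>\<close>
      therefore serves for \<open>\<V>\<close> too.\<close>
    have "X closure_of \<Union>(\<W> n) \<subseteq> X closure_of \<Union>(\<V> n)" for n
      using V(2) by (simp add: closure_of_minimal)
    then have "\<exists>n. F \<subseteq> X closure_of \<Union>(\<V> n)" if "finite F" "F \<subseteq> topspace X" for F
      using W(2) [THEN spec, of F] that by fast
    then show "\<exists>\<V>. (\<forall>n. finite (\<V> n) \<and> \<V> n \<subseteq> \<U> n) \<and>
        (\<forall>F. finite F \<and> F \<subseteq> topspace X \<longrightarrow> (\<exists>n. F \<subseteq> X closure_of \<Union>(\<V> n)))"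
      using V(1) by (intro exI [of _ \<V>]) simp
  qed
qed

text \<open>From right to left two things are regularised, the covers and the open test sets. Both
  changes are undone by one fact: an open set meeting the closure of a set meets the set
  itself.\<close>

lemma weakly_Scheepers_Sakai_iff_regular_open:
  "weakly_Scheepers_Sakai X \<longleftrightarrow>
    (\<forall>\<U> :: nat \<Rightarrow> 'a set set. (\<forall>n. regular_open_cover X (\<U> n)) \<longrightarrow>
      (\<exists>\<V> :: nat \<Rightarrow> 'a set set. (\<forall>n. finite (\<V> n) \<and> \<V> n \<subseteq> \<U> n) \<and>
        (\<forall>\<F>. finite \<F> \<and> (\<forall>U\<in>\<F>. regular_open_in X U \<and> U \<noteq> {}) \<longrightarrow>
          (\<exists>n. \<forall>U\<in>\<F>. U \<inter> \<Union>(\<V> n) \<noteq> {}))))"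
  (is "_ \<longleftrightarrow> ?R")
proof
  assume L: "weakly_Scheepers_Sakai X"
  show ?R
  proof (intro allI impI)
    fix \<U> :: "nat \<Rightarrow> 'a set set"
    assume "\<forall>n. regular_open_cover X (\<U> n)"
    then have "\<forall>n. open_cover X (\<U> n)"
      using regular_open_cover_imp_open_cover by blast
    then obtain \<V> where V: "\<forall>n. finite (\<V> n) \<and> \<V> n \<subseteq> \<U> n"
      "\<forall>\<F>. finite \<F> \<and> (\<forall>U\<in>\<F>. openin X U \<and> U \<noteq> {}) \<longrightarrow>
        (\<exists>n. \<forall>U\<in>\<F>. U \<inter> \<Union>(\<V> n) \<noteq> {})"
      using L [unfolded weakly_Scheepers_Sakai_def, THEN spec, of \<U>] by blast
    have "\<exists>n. \<forall>U\<in>\<F>. U \<inter> \<Union>(\<V> n) \<noteq> {}"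
      if "finite \<F>" "\<forall>U\<in>\<F>. regular_open_in X U \<and> U \<noteq> {}" for \<F>
      using V(2) [THEN spec, of \<F>] that by (simp add: regular_open_in_imp_openin)
    then show "\<exists>\<V>. (\<forall>n. finite (\<V> n) \<and> \<V> n \<subseteq> \<U> n) \<and>
        (\<forall>\<F>. finite \<F> \<and> (\<forall>U\<in>\<F>. regular_open_in X U \<and> U \<noteq> {}) \<longrightarrow>
          (\<exists>n. \<forall>U\<in>\<F>. U \<inter> \<Union>(\<V> n) \<noteq> {}))"
      using V(1) by (intro exI [of _ \<V>]) simp
  qed
next
  assume R: ?R
  show "weakly_Scheepers_Sakai X"
    unfolding weakly_Scheepers_Sakai_def
  proof (intro allI impI)
    fix \<U> :: "nat \<Rightarrow> 'a set set"
    assume U: "\<forall>n. open_cover X (\<U> n)"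
    define r where "r U = X interior_of (X closure_of U)" for U
    have "\<forall>n. regular_open_cover X (r ` \<U> n)"
      unfolding r_def using U regular_open_cover_interior_of_closure_of by blast
    then obtain \<W> where W: "\<forall>n. finite (\<W> n) \<and> \<W> n \<subseteq> r ` \<U> n"
      "\<forall>\<F>. finite \<F> \<and> (\<forall>U\<in>\<F>. regular_open_in X U \<and> U \<noteq> {}) \<longrightarrow>
        (\<exists>n. \<forall>U\<in>\<F>. U \<inter> \<Union>(\<W> n) \<noteq> {})"
      using R [rule_format, of "\<lambda>n. r ` \<U> n"] by blast
    have fin: "finite (\<W> n)"
      and sub: "\<W> n \<subseteq> (\<lambda>U. X interior_of (X closure_of U)) ` \<U> n" for n
      using W(1) by (simp_all add: r_def)
    obtain \<V> where V: "\<forall>n. finite (\<V> n) \<and> \<V> n \<subseteq> \<U> n"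
      "\<forall>n. \<Union>(\<W> n) \<subseteq> X closure_of \<Union>(\<V> n)"
      by (rule finite_subfamilies_dense [of \<W> X \<U>, OF fin sub])
    have "\<exists>n. \<forall>G\<in>\<F>. G \<inter> \<Union>(\<V> n) \<noteq> {}"
      if F: "finite \<F>" "\<forall>G\<in>\<F>. openin X G \<and> G \<noteq> {}" for \<F>
    proof -
      \<comment> \<open>Test sets stay nonempty under \<open>r\<close> because an open
        \<open>G\<close> is contained in \<open>r G\<close>.\<close>
      have "finite (r ` \<F>) \<and> (\<forall>G\<in>r ` \<F>. regular_open_in X G \<and> G \<noteq> {})"
        using F openin_subset_interior_of_closure_of regular_open_in_interior_of_closure_of
        unfolding r_def by fastforce
      then obtain n where n: "\<forall>G\<in>r ` \<F>. G \<inter> \<Union>(\<W> n) \<noteq> {}"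
        using W(2) by meson
      have "G \<inter> \<Union>(\<V> n) \<noteq> {}" if "G \<in> \<F>" for G
      proof -
        \<comment> \<open>First removal of a closure: \<open>r G\<close> meets
          \<open>\<Union>(\<W> n)\<close>, which lies in the closure of
          \<open>\<Union>(\<V> n)\<close>, and \<open>r G\<close> is open.\<close>
        have "r G \<inter> X closure_of \<Union>(\<V> n) \<noteq> {}"
          using n that V(2) by blast
        then have "r G \<inter> \<Union>(\<V> n) \<noteq> {}"
          using openin_Int_closure_of_nonempty openin_interior_of unfolding r_def by metis
        \<comment> \<open>Second removal, with the roles exchanged: \<open>r G\<close> lies in the
          closure of \<open>G\<close>, and now \<open>\<Union>(\<V> n)\<close> is the open set, as a
          union of members of an open cover.\<close>
        then have "\<Union>(\<V> n) \<inter> X closure_of G \<noteq> {}"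
          unfolding r_def using interior_of_subset by fastforce
        then have "\<Union>(\<V> n) \<inter> G \<noteq> {}"
          using openin_Int_closure_of_nonempty openin_open_cover U V(1) by metis
        then show ?thesis
          by blast
      qed
      then show ?thesis
        by blast
    qed
    then show "\<exists>\<V>. (\<forall>n. finite (\<V> n) \<and> \<V> n \<subseteq> \<U> n) \<and>
        (\<forall>\<F>. finite \<F> \<and> (\<forall>U\<in>\<F>. openin X U \<and> U \<noteq> {}) \<longrightarrow>
          (\<exists>n. \<forall>U\<in>\<F>. U \<inter> \<Union>(\<V> n) \<noteq> {}))"
      using V(1) by (intro exI [of _ \<V>]) simp
  qed
qed

text \<open>Finite sets must lie in \<open>\<Union>(\<V> n)\<close> itself and not merely in its
  closure, so interiors of closures would be too large. Regularity supplies true refinements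
  instead.\<close>

lemma weakly_Scheepers_Kocinac_iff_regular_open:
  assumes "regular_space X"
  shows "weakly_Scheepers_Kocinac X \<longleftrightarrow>
    (\<forall>\<U> :: nat \<Rightarrow> 'a set set. (\<forall>n. regular_open_cover X (\<U> n)) \<longrightarrow>
      (\<exists>Y. \<exists>\<V> :: nat \<Rightarrow> 'a set set. dense_in X Y \<and>
        (\<forall>n. finite (\<V> n) \<and> \<V> n \<subseteq> \<U> n) \<and>
        (\<forall>F. finite F \<and> F \<subseteq> Y \<longrightarrow> (\<exists>n. F \<subseteq> \<Union>(\<V> n)))))"
  (is "_ \<longleftrightarrow> ?R")
proof
  assume L: "weakly_Scheepers_Kocinac X"
  show ?R
  proof (intro allI impI)
    fix \<U> :: "nat \<Rightarrow> 'a set set"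
    assume "\<forall>n. regular_open_cover X (\<U> n)"
    then have "\<forall>n. open_cover X (\<U> n)"
      using regular_open_cover_imp_open_cover by blast
    then show "\<exists>Y \<V>. dense_in X Y \<and> (\<forall>n. finite (\<V> n) \<and> \<V> n \<subseteq> \<U> n) \<and>
        (\<forall>F. finite F \<and> F \<subseteq> Y \<longrightarrow> (\<exists>n. F \<subseteq> \<Union>(\<V> n)))"
      by (rule L [unfolded weakly_Scheepers_Kocinac_def, THEN spec, THEN mp])
  qed
next
  assume R: ?R
  show "weakly_Scheepers_Kocinac X"
    unfolding weakly_Scheepers_Kocinac_def
  proof (intro allI impI)
    fix \<U> :: "nat \<Rightarrow> 'a set set"
    assume U: "\<forall>n. open_cover X (\<U> n)"
    define \<U>' where "\<U>' n = {R. regular_open_in X R \<and> (\<exists>U\<in>\<U> n. R \<subseteq> U)}" for n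
    have "\<forall>n. regular_open_cover X (\<U>' n)"
      unfolding \<U>'_def using U regular_open_cover_refinement [OF assms] by blast
    then obtain Y \<W> where W: "dense_in X Y" "\<forall>n. finite (\<W> n) \<and> \<W> n \<subseteq> \<U>' n"
      "\<forall>F. finite F \<and> F \<subseteq> Y \<longrightarrow> (\<exists>n. F \<subseteq> \<Union>(\<W> n))"
      using R [THEN spec, of \<U>'] by blast
    have fin: "finite (\<W> n)" for n
      using W(2) by simp
    have sub: "\<exists>U\<in>\<U> n. S \<subseteq> U" if "S \<in> \<W> n" for n S
    proof -
      have "S \<in> \<U>' n"
        using W(2) that by auto
      then show ?thesis
        by (simp add: \<U>'_def)
    qed
    obtain \<V> where V: "\<forall>n. finite (\<V> n) \<and> \<V> n \<subseteq> \<U> n"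
      "\<forall>n. \<forall>W\<in>\<W> n. \<exists>U\<in>\<V> n. W \<subseteq> U"
      by (rule finite_subfamilies_via_relation [of \<W> \<U> "(\<subseteq>)", OF fin sub])
    \<comment> \<open>Passing from \<open>\<W>\<close> to \<open>\<V>\<close> only enlarges the
      unions, so the dense set \<open>Y\<close> obtained for the refined covers can be kept
      unchanged.\<close>
    have "\<Union>(\<W> n) \<subseteq> \<Union>(\<V> n)" for n
      using V(2) by blast
    then have "\<exists>n. F \<subseteq> \<Union>(\<V> n)" if "finite F" "F \<subseteq> Y" for F
      using W(3) [THEN spec, of F] that by (meson subset_trans)
    then show "\<exists>Y \<V>. dense_in X Y \<and> (\<forall>n. finite (\<V> n) \<and> \<V> n \<subseteq> \<U> n) \<and>
        (\<forall>F. finite F \<and> F \<subseteq> Y \<longrightarrow> (\<exists>n. F \<subseteq> \<Union>(\<V> n)))"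
      using V(1) W(1) by (intro exI [of _ Y] exI [of _ \<V>]) simp
  qed
qed

theorem proposition3p1:
  fixes X :: "'a topology"
  shows "(almost_Scheepers X \<longleftrightarrow>
      (\<forall>\<U> :: nat \<Rightarrow> 'a set set. (\<forall>n. regular_open_cover X (\<U> n)) \<longrightarrow>
        (\<exists>\<V> :: nat \<Rightarrow> 'a set set. (\<forall>n. finite (\<V> n) \<and> \<V> n \<subseteq> \<U> n) \<and>
          (\<forall>F. finite F \<and> F \<subseteq> topspace X \<longrightarrow>
            (\<exists>n. F \<subseteq> X closure_of \<Union>(\<V> n))))))
    \<and> (weakly_Scheepers_Sakai X \<longleftrightarrow>
      (\<forall>\<U> :: nat \<Rightarrow> 'a set set. (\<forall>n. regular_open_cover X (\<U> n)) \<longrightarrow>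
        (\<exists>\<V> :: nat \<Rightarrow> 'a set set. (\<forall>n. finite (\<V> n) \<and> \<V> n \<subseteq> \<U> n) \<and>
          (\<forall>\<F>. finite \<F> \<and> (\<forall>U\<in>\<F>. regular_open_in X U \<and> U \<noteq> {}) \<longrightarrow>
            (\<exists>n. \<forall>U\<in>\<F>. U \<inter> \<Union>(\<V> n) \<noteq> {})))))
    \<and> (regular_space X \<longrightarrow>
      (weakly_Scheepers_Kocinac X \<longleftrightarrow>
      (\<forall>\<U> :: nat \<Rightarrow> 'a set set. (\<forall>n. regular_open_cover X (\<U> n)) \<longrightarrow>
        (\<exists>Y. \<exists>\<V> :: nat \<Rightarrow> 'a set set. dense_in X Y \<and>
          (\<forall>n. finite (\<V> n) \<and> \<V> n \<subseteq> \<U> n) \<and>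
          (\<forall>F. finite F \<and> F \<subseteq> Y \<longrightarrow> (\<exists>n. F \<subseteq> \<Union>(\<V> n)))))))"
proof (rule conjI [OF almost_Scheepers_iff_regular_open
      conjI [OF weakly_Scheepers_Sakai_iff_regular_open]], rule impI)
qed (rule weakly_Scheepers_Kocinac_iff_regular_open)

end
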